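(* $$\frac{\sin(6\pi/17)}{\sin(3\pi/17)}-\frac{\sin(4\pi/17)}{\sin(2\pi/17)}-\frac{\sin(8\pi/17)}{\sin(4\pi/17)}+\frac{\sin(2\pi/17)}{\sin(\pi/17)}+\frac{\sin(7\pi/17)}{\sin(5\pi/17)}-\frac{\sin(5\pi/17)}{\sin(6\pi/17)}+\frac{\sin(3\pi/17)}{\sin(7\pi/17)}-\frac{\sin(\pi/17)}{\sin(8\pi/17)}=1.$$ *)

theory Defs
  imports Complex_Main
begin

end

theory Submission
  imports Defs
begin

text \<open>Since \<open>sin (17 - j) x = sin j x\<close> for \<open>x = \<pi> / 17\<close>, every quotient has the form
  \<open>sin 2kx / sin kx = 2 cos kx\<close>. The resulting alternating sum of the \<open>2 cos kx\<close>, \<open>1 \<le> k \<le> 8\<close>,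
  telescopes after multiplication by \<open>cos (x / 2)\<close>, and the boundary term is \<open>cos (\<pi> / 2) = 0\<close>.\<close>

text \<open>By product-to-sum, each term times \<open>cos (x / 2)\<close> splits into cosines at the
  two neighbouring half-integer multiples of \<open>x\<close>, which cancel between successive
  terms.\<close>

lemma alternating_cos_sum:
  fixes x :: real
  shows "(\<Sum>k<n. (-1) ^ k * (2 * cos (real (Suc k) * x))) * cos (x / 2)
           = cos (x / 2) - (-1) ^ n * cos ((real n + 1 / 2) * x)"
proof (induction n)
  case 0
  then show ?case by simp
next
  case (Suc n)
  have "2 * cos (real (Suc n) * x) * cos (x / 2)
          = cos ((real n + 1 / 2) * x) + cos ((real (Suc n) + 1 / 2) * x)"
    using cos_times_cos[of "real (Suc n) * x" "x / 2"] by (simp add: algebra_simps)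
  then have "(-1) ^ n * (2 * cos (real (Suc n) * x)) * cos (x / 2)
          = (-1) ^ n * (cos ((real n + 1 / 2) * x) + cos ((real (Suc n) + 1 / 2) * x))"
    by simp
  with Suc.IH show ?case
    by (simp add: distrib_right distrib_left del: of_nat_Suc)
qed

lemma alternating_cos_sum_eq_1:
  assumes "n > 0"
  shows "(\<Sum>k<n. (-1) ^ k * (2 * cos (real (Suc k) * (pi / (2 * real n + 1))))) = 1"
proof -
  define x where "x = pi / (2 * real n + 1)"
  \<comment> \<open>For \<open>n = 0\<close> one would get \<open>x = pi\<close>, and the factor
    \<open>cos (x / 2)\<close> to be cancelled would vanish.\<close>
  have "0 < x" "x < pi"
    using assms by (auto simp: x_def field_simps)
  then have "cos (x / 2) > 0"
    by (intro cos_gt_zero) auto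
  moreover have "(real n + 1 / 2) * x = pi / 2"
    by (simp add: x_def field_simps)
  then have "cos ((real n + 1 / 2) * x) = 0"
    by (simp only: cos_pi_half)
  ultimately show ?thesis
    using alternating_cos_sum[of x n] unfolding x_def[symmetric] by simp
qed

lemma sin_double_divide_sin:
  fixes x :: real
  assumes "sin x \<noteq> 0"
  shows "sin (2 * x) / sin x = 2 * cos x"
  using assms by (simp add: sin_double)

theorem theorem4p2:
  "sin (6 * pi / 17) / sin (3 * pi / 17)
     - sin (4 * pi / 17) / sin (2 * pi / 17)
     - sin (8 * pi / 17) / sin (4 * pi / 17)
     + sin (2 * pi / 17) / sin (pi / 17)
     + sin (7 * pi / 17) / sin (5 * pi / 17)
     - sin (5 * pi / 17) / sin (6 * pi / 17)
     + sin (3 * pi / 17) / sin (7 * pi / 17)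
     - sin (pi / 17) / sin (8 * pi / 17) = 1"
proof -
  have even: "sin (2 * k * pi / 17) / sin (k * pi / 17) = 2 * cos (k * pi / 17)"
    if "0 < k" "k < 17" for k :: real
  proof -
    have "sin (k * pi / 17) > 0"
      using that by (intro sin_gt_zero) auto
    then show ?thesis
      using sin_double_divide_sin[of "k * pi / 17"] by (simp add: mult.assoc)
  qed
  \<comment> \<open>For \<open>k\<close> = 5, 6, 7, 8 the double angle is reflected: 7, 5, 3, 1 in
    place of 10, 12, 14, 16.\<close>
  have odd: "sin ((17 - 2 * k) * pi / 17) / sin (k * pi / 17) = 2 * cos (k * pi / 17)"
    if "0 < k" "k < 17" for k :: real
  proof -
    have "(17 - 2 * k) * pi / 17 = pi - 2 * k * pi / 17"
      by (simp add: field_simps)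
    then have "sin ((17 - 2 * k) * pi / 17) = sin (2 * k * pi / 17)"
      by (simp only: sin_pi_minus)
    then show ?thesis
      using even[OF that] by simp
  qed
  show ?thesis
    \<comment> \<open>Here \<open>2 * 8 + 1 = 17\<close>, and \<open>2 * cos (k * pi / 17)\<close>
      enters the goal with a plus sign exactly for odd \<open>k\<close>.\<close>
    using even[of 1] even[of 2] even[of 3] even[of 4] odd[of 5] odd[of 6] odd[of 7] odd[of 8]
      alternating_cos_sum_eq_1[of 8]
    by (simp add: eval_nat_numeral)
qed

end
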